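(* Let $A$ be a unital $C^*$-algebra. Then the following are equivalent: (1) $A$ has no tracial states. (2) There exist an integer $n\ge 2$ and elements $b_1,b_2,\ldots,b_n\in A$ such that $\sum_{i=1}^n b_i^*b_i=1$ and $\left\|\sum_{i=1}^n b_ib_i^*\right\|<1$. (3) There exists an integer $n\ge 2$ such that any element of $A$ can be expressed as a sum of $n$ commutators and any positive element of $A$ can be expressed as a sum of at most $n$ self-adjoint commutators.
   Context: For $a,b$ in a $C^*$-algebra $A$, their commutator is $[a,b]=ab-ba$. A self-adjoint commutator is a commutator of the form $[a^*,a]=a^*a-aa^*$ with $a\in A$. A tracial state on a unital $C^*$-algebra $A$ is a state $\tau$ on $A$ (a positive linear functional with $\tau(1)=1$) such that $\tau(ab)=\tau(ba)$ for all $a,b\in A$. In (3), the integer $n$ depends only on $A$, and the same $n$ serves for both assertions and for all elements of $A$. *)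

theory Defs
  imports "HOL-Analysis.Analysis"
begin

(* The type class describes unital complex C*-algebras.  The real scalar multiplication of the
   library is the restriction of scaleC to the reals.  The unit comes from monoid_mult rather than
   from real_normed_algebra_1, because the latter requires 0 \<noteq> 1; hence the zero algebra is
   included, and norm 1 = 1 follows from the C*-identity whenever 0 \<noteq> 1. *)

class unital_cstar_algebra = real_normed_algebra + monoid_mult + banach +
  fixes scaleC :: "complex \<Rightarrow> 'a \<Rightarrow> 'a"  (infixr "*\<^sub>C" 75)
    and star :: "'a \<Rightarrow> 'a"
  assumes scaleC_add_right: "c *\<^sub>C (x + y) = c *\<^sub>C x + c *\<^sub>C y"
    and scaleC_add_left: "(c + d) *\<^sub>C x = c *\<^sub>C x + d *\<^sub>C x"
    and scaleC_scaleC: "c *\<^sub>C (d *\<^sub>C x) = (c * d) *\<^sub>C x"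
    and scaleC_of_real: "complex_of_real r *\<^sub>C x = r *\<^sub>R x"
    and mult_scaleC_left: "(c *\<^sub>C x) * y = c *\<^sub>C (x * y)"
    and mult_scaleC_right: "x * (c *\<^sub>C y) = c *\<^sub>C (x * y)"
    and norm_scaleC: "norm (c *\<^sub>C x) = cmod c * norm x"
    and star_add: "star (x + y) = star x + star y"
    and star_scaleC: "star (c *\<^sub>C x) = cnj c *\<^sub>C star x"
    and star_mult: "star (x * y) = star y * star x"
    and star_star: "star (star x) = x"
    and cstar_identity: "norm (star x * x) = (norm x)\<^sup>2"

definition commutator :: "'a::unital_cstar_algebra \<Rightarrow> 'a \<Rightarrow> 'a" where
  "commutator a b = a * b - b * a"

definition positive_element :: "'a::unital_cstar_algebra \<Rightarrow> bool" where
  "positive_element a \<longleftrightarrow> (\<exists>x. a = star x * x)"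

definition complex_linear_functional :: "('a::unital_cstar_algebra \<Rightarrow> complex) \<Rightarrow> bool" where
  "complex_linear_functional \<phi> \<longleftrightarrow>
     (\<forall>x y. \<phi> (x + y) = \<phi> x + \<phi> y) \<and> (\<forall>c x. \<phi> (c *\<^sub>C x) = c * \<phi> x)"

definition positive_functional :: "('a::unital_cstar_algebra \<Rightarrow> complex) \<Rightarrow> bool" where
  "positive_functional \<phi> \<longleftrightarrow>
     complex_linear_functional \<phi> \<and> (\<forall>a. positive_element a \<longrightarrow> \<phi> a \<in> \<real>\<^sub>\<ge>\<^sub>0)"

definition state :: "('a::unital_cstar_algebra \<Rightarrow> complex) \<Rightarrow> bool" where
  "state \<phi> \<longleftrightarrow> positive_functional \<phi> \<and> \<phi> 1 = 1"

definition tracial_state :: "('a::unital_cstar_algebra \<Rightarrow> complex) \<Rightarrow> bool" where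
  "tracial_state \<tau> \<longleftrightarrow> state \<tau> \<and> (\<forall>a b. \<tau> (a * b) = \<tau> (b * a))"

definition sum_of_commutators :: "nat \<Rightarrow> 'a::unital_cstar_algebra \<Rightarrow> bool" where
  "sum_of_commutators n a \<longleftrightarrow> (\<exists>x y. a = (\<Sum>i=1..n. commutator (x i) (y i)))"

definition sum_of_sa_commutators :: "nat \<Rightarrow> 'a::unital_cstar_algebra \<Rightarrow> bool" where
  "sum_of_sa_commutators n a \<longleftrightarrow> (\<exists>x. a = (\<Sum>i=1..n. commutator (star (x i)) (x i)))"

end

theory Submission
  imports Defs
begin

text \<open>
  Suppose there is no tracial state, and let \<open>V\<close> be the real span of the self-adjoint commutators.
  If \<open>1\<close> had distance \<open>1\<close> from \<open>V\<close>, Hahn-Banach would give a real functional of norm \<open>1\<close> that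
  vanishes on \<open>V\<close> and is \<open>1\<close> at \<open>1\<close>; such a functional is positive, and its complexification is a
  tracial state.  Hence \<open>norm (1 - (X - Y)) < 1\<close> for some \<open>X = \<Sum> x\<^sub>i\<^sup>* x\<^sub>i\<close> and \<open>Y = \<Sum> x\<^sub>i x\<^sub>i\<^sup>*\<close>.
  Adding \<open>M - X\<close> to both sums, for a large scalar \<open>M\<close>, and dividing by \<open>M\<close> gives (2).

  Given (2), the positive map \<open>T x = \<Sum> b\<^sub>i x b\<^sub>i\<^sup>*\<close> is a strict contraction on self-adjoint elements,
  so every \<open>a\<close> is \<open>c - T c\<close> for some \<open>c\<close>, positive if \<open>a\<close> is.  Since \<open>\<Sum> b\<^sub>i\<^sup>* b\<^sub>i = 1\<close>, one has
  \<open>c - T c = \<Sum> [b\<^sub>i\<^sup>*, b\<^sub>i c]\<close>, and \<open>c - T c = \<Sum> [(b\<^sub>i d)\<^sup>*, b\<^sub>i d]\<close> if \<open>c = d\<^sup>2\<close> with \<open>d\<close> self-adjoint.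
\<close>

section \<open>The Hahn-Banach theorem for sublinear functionals\<close>

text \<open>Homogeneity is asked for only as an inequality with positive factors; rescaling by
  \<open>1/t\<close> turns it into an equality.\<close>

definition sublinear :: "('a::real_vector \<Rightarrow> real) \<Rightarrow> bool" where
  "sublinear p \<longleftrightarrow> (\<forall>x y. p (x + y) \<le> p x + p y) \<and> (\<forall>t x. 0 < t \<longrightarrow> p (t *\<^sub>R x) \<le> t * p x)"

lemma sublinear_add: "sublinear p \<Longrightarrow> p (x + y) \<le> p x + p y"
  and sublinear_scaleR_le: "sublinear p \<Longrightarrow> 0 < t \<Longrightarrow> p (t *\<^sub>R x) \<le> t * p x"
  by (auto simp: sublinear_def)

lemma sublinear_scaleR:
  assumes "sublinear p" "0 < t"
  shows "p (t *\<^sub>R x) = t * p x"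
proof (rule antisym)
  show "p (t *\<^sub>R x) \<le> t * p x" using assms by (rule sublinear_scaleR_le)
  have "p ((1/t) *\<^sub>R (t *\<^sub>R x)) \<le> (1/t) * p (t *\<^sub>R x)"
    using assms by (intro sublinear_scaleR_le) auto
  then show "t * p x \<le> p (t *\<^sub>R x)"
    using assms(2) by (simp add: field_simps)
qed

lemma sublinear_zero: "sublinear p \<Longrightarrow> p 0 = 0"
  using sublinear_scaleR[of p 2 0] by simp

lemma sublinear_ge_minus: "sublinear p \<Longrightarrow> - p (- x) \<le> p x"
  using sublinear_add[of p x "- x"] by (simp add: sublinear_zero)

text \<open>A minimal sublinear \<open>m\<close> satisfies \<open>reduce m y = m\<close> for all \<open>y\<close>, hence \<open>m (- y) = - m y\<close>,
  which makes it linear.\<close>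

definition reduce :: "('a::real_vector \<Rightarrow> real) \<Rightarrow> 'a \<Rightarrow> 'a \<Rightarrow> real" where
  "reduce p y x = (INF t\<in>{0..}. p (x + t *\<^sub>R y) - t * p y)"

text \<open>The infimum is over a set bounded below: \<open>p (t y) = t * p y\<close> makes
  \<open>- p (- x)\<close> a lower bound.\<close>

lemma reduce_le:
  assumes "sublinear p" "0 \<le> t"
  shows "reduce p y x \<le> p (x + t *\<^sub>R y) - t * p y"
  unfolding reduce_def
proof (rule cINF_lower)
  show "bdd_below ((\<lambda>t. p (x + t *\<^sub>R y) - t * p y) ` {0..})"
  proof (rule bdd_belowI2)
    fix t :: real assume "t \<in> {0..}"
    then have "p (t *\<^sub>R y) = t * p y"
      using assms(1) by (cases "t = 0") (auto simp: sublinear_scaleR sublinear_zero)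
    then show "- p (- x) \<le> p (x + t *\<^sub>R y) - t * p y"
      using sublinear_add[OF assms(1), of "x + t *\<^sub>R y" "- x"] by simp
  qed
qed (use assms in auto)

lemma reduce_greatest: "(\<And>t. 0 \<le> t \<Longrightarrow> m \<le> p (x + t *\<^sub>R y) - t * p y) \<Longrightarrow> m \<le> reduce p y x"
  unfolding reduce_def by (rule cINF_greatest) auto

lemma reduce_le_self: "sublinear p \<Longrightarrow> reduce p y x \<le> p x"
  using reduce_le[of p 0 y x] by simp

lemma reduce_minus: "sublinear p \<Longrightarrow> reduce p y (- y) \<le> - p y"
  using reduce_le[of p 1 y "- y"] by (simp add: sublinear_zero)

lemma sublinear_reduce:
  assumes "sublinear p"
  shows "sublinear (reduce p y)"
  unfolding sublinear_def
proof (intro conjI allI impI)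
  fix x z
  \<comment> \<open>The two infima are treated one after the other: \<open>s\<close> for
    \<open>x\<close> and \<open>t\<close> for \<open>z\<close> are matched by \<open>s + t\<close>
    for \<open>x + z\<close>.\<close>
  have "reduce p y (x + z) - reduce p y z \<le> reduce p y x"
  proof (rule reduce_greatest)
    fix s :: real assume s: "0 \<le> s"
    have "reduce p y (x + z) - (p (x + s *\<^sub>R y) - s * p y) \<le> reduce p y z"
    proof (rule reduce_greatest)
      fix t :: real assume t: "0 \<le> t"
      have "reduce p y (x + z) \<le> p ((x + s *\<^sub>R y) + (z + t *\<^sub>R y)) - (s + t) * p y"
        using reduce_le[OF assms, of "s + t" y "x + z"] s t by (simp add: algebra_simps)
      also have "\<dots> \<le> p (x + s *\<^sub>R y) + p (z + t *\<^sub>R y) - (s + t) * p y"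
        using sublinear_add[OF assms] by simp
      finally show "reduce p y (x + z) - (p (x + s *\<^sub>R y) - s * p y) \<le> p (z + t *\<^sub>R y) - t * p y"
        by (simp add: algebra_simps)
    qed
    then show "reduce p y (x + z) - reduce p y z \<le> p (x + s *\<^sub>R y) - s * p y" by simp
  qed
  then show "reduce p y (x + z) \<le> reduce p y x + reduce p y z" by simp
next
  fix t :: real and x
  assume t: "0 < t"
  have "(1/t) * reduce p y (t *\<^sub>R x) \<le> reduce p y x"
  proof (rule reduce_greatest)
    fix s :: real assume s: "0 \<le> s"
    have "reduce p y (t *\<^sub>R x) \<le> p (t *\<^sub>R (x + s *\<^sub>R y)) - (t * s) * p y"
      using reduce_le[OF assms, of "t * s" y "t *\<^sub>R x"] s t by (simp add: algebra_simps)
    also have "\<dots> = t * (p (x + s *\<^sub>R y) - s * p y)"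
      using t by (simp only: sublinear_scaleR[OF assms]) (simp add: algebra_simps)
    finally show "(1/t) * reduce p y (t *\<^sub>R x) \<le> p (x + s *\<^sub>R y) - s * p y"
      using t by (simp add: field_simps)
  qed
  then show "reduce p y (t *\<^sub>R x) \<le> t * reduce p y x"
    using t by (simp add: field_simps)
qed

text \<open>Zorn's lemma for the reversed pointwise order. The pointwise infimum of a chain is
  finite, since every sublinear functional below \<open>p\<close> lies above
  \<open>- p (- x)\<close>.\<close>

lemma minimal_sublinear_below:
  assumes "sublinear p"
  obtains m where "sublinear m" "m \<le> p" "\<And>q. sublinear q \<Longrightarrow> q \<le> m \<Longrightarrow> q = m"
proof -
  define S where "S = {q. sublinear q \<and> q \<le> p}"
  have "\<exists>m\<in>S. \<forall>q\<in>S. q \<le> m \<longrightarrow> q = m"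
  proof (rule predicate_Zorn)
    show "partial_order_on S (relation_of (\<lambda>q r. r \<le> q) S)"
      by (rule partial_order_on_relation_ofI) auto
  next
    fix C assume C: "C \<in> Chains (relation_of (\<lambda>q r. r \<le> q) S)"
    have CS: "C \<subseteq> S" and total: "\<And>q r. q \<in> C \<Longrightarrow> r \<in> C \<Longrightarrow> q \<le> r \<or> r \<le> q"
      using C by (auto simp: Chains_def relation_of_def)
    show "\<exists>u\<in>S. \<forall>q\<in>C. u \<le> q"
    proof (cases "C = {}")
      case True
      then show ?thesis using assms by (auto simp: S_def)
    next
      case False
      define u where "u = (\<lambda>x. INF q\<in>C. q x)"
      have bdd: "bdd_below ((\<lambda>q. q x) ` C)" for x
      proof (rule bdd_belowI2)
        fix q assume "q \<in> C"
        then have q: "sublinear q" "q \<le> p" using CS by (auto simp: S_def)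
        show "- p (- x) \<le> q x"
          using sublinear_ge_minus[OF q(1), of x] le_funD[OF q(2), of "- x"] by linarith
      qed
      have lower: "u x \<le> q x" if "q \<in> C" for q x
        unfolding u_def by (rule cINF_lower[OF bdd that])
      have greatest: "m \<le> u x" if "\<And>q. q \<in> C \<Longrightarrow> m \<le> q x" for m x
        unfolding u_def using False that by (rule cINF_greatest)
      have "sublinear u"
        unfolding sublinear_def
      proof (intro conjI allI impI)
        fix x y
        \<comment> \<open>The smaller of \<open>q\<close> and \<open>r\<close> is itself in the
          chain, and its subadditivity gives the bound for two different members.\<close>
        have *: "u (x + y) \<le> q x + r y" if qr: "q \<in> C" "r \<in> C" for q r
        proof -
          obtain s where s: "s \<in> C" "s \<le> q" "s \<le> r"
            using total[OF qr] qr by auto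
          have "u (x + y) \<le> s (x + y)" using s(1) by (rule lower)
          also have "\<dots> \<le> s x + s y" using s(1) CS by (auto simp: S_def sublinear_add)
          also have "\<dots> \<le> q x + r y" using s by (auto intro!: add_mono simp: le_fun_def)
          finally show ?thesis .
        qed
        have "u (x + y) - u y \<le> u x"
        proof (rule greatest)
          fix q assume q: "q \<in> C"
          have "u (x + y) - q x \<le> u y"
            by (rule greatest) (use *[OF q] in \<open>simp add: diff_le_eq add.commute\<close>)
          then show "u (x + y) - u y \<le> q x" by simp
        qed
        then show "u (x + y) \<le> u x + u y" by simp
      next
        fix t :: real and x assume t: "0 < t"
        have "(1/t) * u (t *\<^sub>R x) \<le> u x"
        proof (rule greatest)
          fix q assume q: "q \<in> C"
          then have "q (t *\<^sub>R x) \<le> t * q x" using CS t by (auto simp: S_def sublinear_scaleR)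
          then show "(1/t) * u (t *\<^sub>R x) \<le> q x"
            using lower[OF q, of "t *\<^sub>R x"] t by (simp add: field_simps)
        qed
        then show "u (t *\<^sub>R x) \<le> t * u x" using t by (simp add: field_simps)
      qed
      moreover have "u \<le> p"
      proof (rule le_funI)
        fix x
        obtain q where "q \<in> C" "q \<le> p" using False CS by (auto simp: S_def)
        then show "u x \<le> p x" using lower[of q x] by (auto simp: le_fun_def intro: order_trans)
      qed
      ultimately show ?thesis using lower by (auto simp: S_def le_fun_def)
    qed
  qed
  then obtain m where m: "m \<in> S" "\<And>q. q \<in> S \<Longrightarrow> q \<le> m \<Longrightarrow> q = m" by blast
  show thesis
  proof (rule that[of m])
    show "q = m" if "sublinear q" "q \<le> m" for q
      using m that by (auto simp: S_def intro: order_trans)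
  qed (use m in \<open>auto simp: S_def\<close>)
qed

text \<open>The minimal functional is taken below \<open>reduce p z\<close> instead of
  \<open>p\<close>: as \<open>reduce p z (- z)\<close> is at most \<open>- p z\<close>, its value at
  \<open>z\<close> is forced to be \<open>p z\<close>.\<close>

theorem hahn_banach_sublinear:
  assumes "sublinear p"
  obtains f where "linear f" "\<And>x. f x \<le> p x" "f z = p z"
proof -
  obtain m where m: "sublinear m" "m \<le> reduce p z"
    and min: "\<And>q. sublinear q \<Longrightarrow> q \<le> m \<Longrightarrow> q = m"
    using minimal_sublinear_below[OF sublinear_reduce[OF assms]] by blast
  have red: "reduce m y = m" for y
    using min[OF sublinear_reduce[OF m(1)]] reduce_le_self[OF m(1)] by (simp add: le_fun_def)
  have minus: "m (- y) = - m y" for y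
    using reduce_minus[OF m(1), of y] sublinear_ge_minus[OF m(1), of y] by (simp add: red)
  have le: "m x \<le> p x" for x
    using le_funD[OF m(2), of x] reduce_le_self[OF assms, of z x] by linarith
  have "linear m"
  proof (rule linearI)
    fix x y
    show "m (x + y) = m x + m y"
      using sublinear_add[OF m(1), of x y] sublinear_add[OF m(1), of "- x" "- y"]
        minus[of "x + y"] by (simp add: minus)
  next
    fix t :: real and x
    consider "t = 0" | "t > 0" | "- t > 0" by linarith
    then show "m (t *\<^sub>R x) = t *\<^sub>R m x"
    proof cases
      case 3
      then show ?thesis using sublinear_scaleR[OF m(1) 3, of x] minus[of "t *\<^sub>R x"] by simp
    qed (auto simp: sublinear_zero sublinear_scaleR m)
  qed
  moreover have "m z = p z"
    using le_funD[OF m(2), of "- z"] reduce_minus[OF assms, of z] minus[of z] le[of z] by linarith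
  ultimately show thesis using that le by blast
qed

section \<open>Positive elements of a C*-algebra\<close>

lemma star_zero [simp]: "star (0::'a::unital_cstar_algebra) = 0"
  using star_add[of "0::'a" 0] by simp

lemma star_uminus: "star (- x) = - star (x::'a::unital_cstar_algebra)"
  using star_add[of x "- x"] by (simp add: eq_neg_iff_add_eq_0 add.commute)

lemma star_diff: "star (x - y) = star x - star (y::'a::unital_cstar_algebra)"
  using star_add[of x "- y"] by (simp add: star_uminus)

lemma star_scaleR: "star (r *\<^sub>R x) = r *\<^sub>R star (x::'a::unital_cstar_algebra)"
  by (simp flip: scaleC_of_real add: star_scaleC)

lemma star_one [simp]: "star (1::'a::unital_cstar_algebra) = 1"
  using star_mult[of "star (1::'a)" 1] by (simp add: star_star)

lemma norm_star [simp]: "norm (star x) = norm (x::'a::unital_cstar_algebra)"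
proof -
  have le: "norm y \<le> norm (star y)" for y :: 'a
  proof (cases "y = 0")
    case False
    have "norm y * norm y \<le> norm (star y) * norm y"
      using norm_mult_ineq[of "star y" y] by (simp add: cstar_identity power2_eq_square)
    with False show ?thesis by simp
  qed auto
  show ?thesis using le[of x] le[of "star x"] by (simp add: star_star)
qed

lemma bounded_linear_star: "bounded_linear (star :: 'a::unital_cstar_algebra \<Rightarrow> 'a)"
  by (rule bounded_linear_intro[where K = 1]) (auto simp: star_add star_scaleR)

text \<open>The C*-identity leaves the values 0 and 1, and 0 occurs in the zero algebra.\<close>

lemma norm_one_le: "norm (1::'a::unital_cstar_algebra) \<le> 1"
  using cstar_identity[of "1::'a"] by (auto simp: power2_eq_square)

lemma norm_scaleR_one_le: "0 \<le> t \<Longrightarrow> norm (t *\<^sub>R (1::'a::unital_cstar_algebra)) \<le> t"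
  using norm_one_le mult_left_le by fastforce

lemma scaleC_uminus_right: "c *\<^sub>C (- x) = - (c *\<^sub>C (x::'a::unital_cstar_algebra))"
proof -
  have "c *\<^sub>C 0 = (0::'a)" using scaleC_add_right[of c "0::'a" 0] by simp
  then show ?thesis
    using scaleC_add_right[of c x "- x"] by (simp add: eq_neg_iff_add_eq_0 add.commute)
qed

lemma norm_square_selfadj:
  "star h = h \<Longrightarrow> norm (h * h) = norm (h::'a::unital_cstar_algebra) * norm h"
  using cstar_identity[of h] by (simp add: power2_eq_square)

text \<open>The increments of the iteration \<open>y \<mapsto> (x + y\<^sup>2) / 2\<close> are dominated by those of the same scalar
  iteration for \<open>norm x\<close>, which is increasing and bounded by \<open>1\<close>.\<close>

lemma ex_sqrt_one_minus:
  fixes x :: "'a::unital_cstar_algebra"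
  assumes "star x = x" "norm x \<le> 1"
  obtains y where "star y = y" "norm y \<le> 1" "(1 - y) * (1 - y) = 1 - x"
    "\<And>c. c * x = x * c \<Longrightarrow> c * y = y * c"
proof -
  define Y where "Y = rec_nat (0::'a) (\<lambda>_ y. (1/2) *\<^sub>R (x + y * y))"
  define T where "T = rec_nat (0::real) (\<lambda>_ t. (1/2) * (norm x + t * t))"
  have Y0: "Y 0 = 0" and YS: "Y (Suc n) = (1/2) *\<^sub>R (x + Y n * Y n)" for n
    by (simp_all add: Y_def)
  have T0: "T 0 = 0" and TS: "T (Suc n) = (1/2) * (norm x + T n * T n)" for n
    by (simp_all add: T_def)
  \<comment> \<open>What commutes with \<open>x\<close> commutes with every iterate and so with the
    limit; in particular the iterates commute with each other.\<close>
  have comm: "c * Y n = Y n * c" if "c * x = x * c" for c n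
  proof (induction n)
    case (Suc n)
    have "c * (Y n * Y n) = (Y n * Y n) * c" by (metis Suc mult.assoc)
    then show ?case using that by (simp add: YS distrib_left distrib_right)
  qed (simp add: Y0)
  have YY: "Y m * Y n = Y n * Y m" for m n
    by (rule comm) (simp add: comm)
  have T: "0 \<le> T n \<and> T n \<le> 1" for n
  proof (induction n)
    case (Suc n)
    then have "T n * T n \<le> 1" by (simp add: mult_le_one)
    with Suc show ?case using assms(2) by (simp add: TS)
  qed (simp add: T0)
  have Yle: "norm (Y n) \<le> T n" for n
  proof (induction n)
    case (Suc n)
    have "norm (x + Y n * Y n) \<le> norm x + norm (Y n) * norm (Y n)"
      by (meson add_left_mono norm_mult_ineq norm_triangle_ineq order_trans)
    also have "\<dots> \<le> norm x + T n * T n" using Suc by (intro add_left_mono mult_mono) (auto simp: T)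
    finally show ?case by (simp add: YS TS)
  qed (simp add: Y0 T0)
  have step: "norm (Y (Suc n) - Y n) \<le> T (Suc n) - T n" for n
  proof (induction n)
    case 0
    show ?case by (simp add: Y0 T0 YS TS)
  next
    case (Suc n)
    \<comment> \<open>The iterates commute, so the difference of their squares factors.\<close>
    have "Y (Suc (Suc n)) - Y (Suc n) = (1/2) *\<^sub>R ((Y (Suc n) - Y n) * (Y (Suc n) + Y n))"
      using YY[of "Suc n" n]
      by (subst YS, subst (3) YS)
        (simp add: algebra_simps flip: scaleR_diff_right scaleR_add_right)
    then have "norm (Y (Suc (Suc n)) - Y (Suc n))
        \<le> (1/2) * (norm (Y (Suc n) - Y n) * norm (Y (Suc n) + Y n))"
      by (simp add: norm_mult_ineq)
    also have "\<dots> \<le> (1/2) * ((T (Suc n) - T n) * (T (Suc n) + T n))"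
      using Suc Yle[of n] Yle[of "Suc n"] norm_triangle_ineq[of "Y (Suc n)" "Y n"] order_trans[OF norm_ge_zero Suc]
      by (intro mult_left_mono mult_mono) (auto)
    also have "\<dots> = T (Suc (Suc n)) - T (Suc n)"
      by (simp add: TS[of "Suc n"] TS[of n] field_simps)
    finally show ?case .
  qed
  have Tinc: "incseq T"
    using order_trans[OF norm_ge_zero step] by (intro incseq_SucI) simp
  have diff: "norm (Y n - Y m) \<le> T n - T m" if "m \<le> n" for m n
    using that
  proof (induction n rule: dec_induct)
    case (step n)
    then show ?case
      using \<open>norm (Y (Suc n) - Y n) \<le> T (Suc n) - T n\<close>
        norm_triangle_ineq[of "Y (Suc n) - Y n" "Y n - Y m"] by simp
  qed simp
  obtain l where "T \<longlonglongrightarrow> l"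
    using incseq_convergent[OF Tinc, of 1] T by blast
  then have CT: "Cauchy T" by (rule LIMSEQ_imp_Cauchy)
  have "Cauchy Y"
    unfolding Cauchy_altdef2
  proof (intro allI impI)
    fix e :: real assume "e > 0"
    then obtain N where N: "\<And>n. n \<ge> N \<Longrightarrow> dist (T n) (T N) < e"
      using CT unfolding Cauchy_altdef2 by blast
    have "dist (Y n) (Y N) < e" if "n \<ge> N" for n
      using diff[OF that] N[OF that] by (simp add: dist_norm)
    then show "\<exists>N. \<forall>n\<ge>N. dist (Y n) (Y N) < e" by blast
  qed
  then obtain y where y: "Y \<longlonglongrightarrow> y"
    using Cauchy_convergent_iff convergent_def by blast
  have sY: "star (Y n) = Y n" for n
    by (induction n) (simp_all add: Y0 YS star_scaleR star_add star_mult assms(1))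
  have "star y = y"
    using bounded_linear.tendsto[OF bounded_linear_star y] unfolding sY by (rule LIMSEQ_unique[OF _ y])
  moreover have "norm y \<le> 1"
    using Lim_bounded[OF tendsto_norm[OF y], of 0 1] Yle T by (meson order_trans)
  moreover have "y = (1/2) *\<^sub>R (x + y * y)"
  proof (rule LIMSEQ_unique)
    show "(\<lambda>n. Y (Suc n)) \<longlonglongrightarrow> y" using y by (rule LIMSEQ_Suc)
    show "(\<lambda>n. Y (Suc n)) \<longlonglongrightarrow> (1/2) *\<^sub>R (x + y * y)"
      unfolding YS by (intro tendsto_intros y)
  qed
  \<comment> \<open>This fixed-point equation is \<open>(1 - y)\<^sup>2 = 1 - x\<close>
    rearranged.\<close>
  then have "y + y = x + y * y"
    by (metis scaleR_half_double scaleR_right_distrib)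
  then have "(1 - y) * (1 - y) = 1 - x"
    by (simp add: algebra_simps)
  moreover have "c * y = y * c" if "c * x = x * c" for c
  proof (rule LIMSEQ_unique)
    show "(\<lambda>n. c * Y n) \<longlonglongrightarrow> c * y" by (intro tendsto_intros y)
    show "(\<lambda>n. c * Y n) \<longlonglongrightarrow> y * c" unfolding comm[OF that] by (intro tendsto_intros y)
  qed
  ultimately show thesis using that by blast
qed

text \<open>The element \<open>u = g + \<i> v\<close> satisfies \<open>u\<^sup>* u = t\<close>, and \<open>g\<close> is its real part.\<close>

lemma norm_le_of_commuting_squares:
  fixes g v :: "'a::unital_cstar_algebra"
  assumes "star g = g" "star v = v" "g * v = v * g" "g * g + v * v = t *\<^sub>R 1" "0 \<le> t"
  shows "norm (g * g) \<le> t"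
proof -
  define u where "u = g + \<i> *\<^sub>C v"
  have su: "star u = g + (- \<i>) *\<^sub>C v"
    by (simp add: u_def star_add star_scaleC assms)
  have z: "\<i> *\<^sub>C x + (- \<i>) *\<^sub>C x = 0" for x :: 'a
    using scaleC_of_real[of 0 x] by (simp flip: scaleC_add_left)
  have one: "1 *\<^sub>C x = x" for x :: 'a
    using scaleC_of_real[of 1 x] by simp
  have "star u * u = g * g + v * v + (\<i> *\<^sub>C (v * g) + (- \<i>) *\<^sub>C (v * g))"
    unfolding su by (simp add: u_def algebra_simps mult_scaleC_left mult_scaleC_right scaleC_add_right
        scaleC_scaleC one assms(3))
  then have "(norm u)\<^sup>2 = norm (t *\<^sub>R (1::'a))"
    by (simp add: z assms(4) flip: cstar_identity)
  also have "\<dots> \<le> t" using assms(5) by (rule norm_scaleR_one_le)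
  finally have u: "(norm u)\<^sup>2 \<le> t" .
  have "u + star u = g + g" using z[of v] by (simp add: su) (simp add: u_def algebra_simps)
  then have "g = (1/2) *\<^sub>R (u + star u)"
    by (simp add: scaleR_half_double)
  then have "norm g \<le> (1/2) * (norm u + norm (star u))"
    by (metis abs_of_nonneg divide_nonneg_nonneg mult_left_mono norm_scaleR norm_triangle_ineq zero_le_numeral zero_le_one)
  then have "norm g \<le> norm u" by simp
  then have "norm g * norm g \<le> (norm u)\<^sup>2"
    by (simp add: mult_mono power2_eq_square)
  with u show ?thesis by (simp add: norm_square_selfadj assms(1))
qed

text \<open>The working notion of positivity: it admits a norm criterion without spectral theory,
  and is identified with \<open>positive_element\<close> only later.\<close>

definition sa_square :: "'a::unital_cstar_algebra \<Rightarrow> bool" where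
  "sa_square a \<longleftrightarrow> (\<exists>h. star h = h \<and> a = h * h)"

lemma sa_squareI: "star h = h \<Longrightarrow> sa_square (h * h)"
  by (auto simp: sa_square_def)

lemma sa_square_star: "sa_square a \<Longrightarrow> star a = a"
  by (auto simp: sa_square_def star_mult)

lemma sa_square_scaleR:
  assumes "sa_square a" "0 \<le> t"
  shows "sa_square (t *\<^sub>R a)"
proof -
  obtain h where "star h = h" "a = h * h" using assms by (auto simp: sa_square_def)
  then show ?thesis
    using sa_squareI[of "sqrt t *\<^sub>R h"] assms(2) by (simp add: star_scaleR)
qed

lemma sa_square_scaleR_one: "0 \<le> t \<Longrightarrow> sa_square (t *\<^sub>R 1)"
  using sa_square_scaleR[of 1 t] sa_squareI[of 1] by simp

text \<open>The norm bound on \<open>h\<close> encodes that \<open>h\<close> is the positive square root, cf. \<open>sa_squareI_norm\<close> below.\<close>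

lemma ex_sqrt:
  fixes a :: "'a::unital_cstar_algebra"
  assumes "star a = a" "norm (M *\<^sub>R 1 - a) \<le> M"
  obtains h where "star h = h" "a = h * h" "\<And>c. c * a = a * c \<Longrightarrow> c * h = h * c"
    "norm (sqrt M *\<^sub>R 1 - h) \<le> sqrt M"
proof (cases "M = 0")
  case True
  then show ?thesis using assms that[of 0] by simp
next
  case False
  then have M: "M > 0" using order_trans[OF norm_ge_zero assms(2)] by simp
  \<comment> \<open>Division by \<open>M\<close> turns the hypothesis into
    \<open>norm x \<le> 1\<close>; then \<open>a = M (1 - x)\<close> has the root
    \<open>sqrt M (1 - y)\<close>.\<close>
  define x where "x = 1 - (1/M) *\<^sub>R a"
  have "x = (1/M) *\<^sub>R (M *\<^sub>R 1 - a)" using M by (simp add: x_def scaleR_diff_right)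
  then have "norm x \<le> 1" using M assms(2) by (simp add: divide_simps)
  moreover have "star x = x" by (simp add: x_def star_diff star_scaleR assms)
  ultimately obtain y where y: "star y = y" "(1 - y) * (1 - y) = 1 - x"
    "\<And>c. c * x = x * c \<Longrightarrow> c * y = y * c" "norm y \<le> 1"
    using ex_sqrt_one_minus by metis
  show ?thesis
  proof (rule that[of "sqrt M *\<^sub>R (1 - y)"])
    show "star (sqrt M *\<^sub>R (1 - y)) = sqrt M *\<^sub>R (1 - y)" by (simp add: star_scaleR star_diff y)
    show "a = sqrt M *\<^sub>R (1 - y) * sqrt M *\<^sub>R (1 - y)"
      using M by (simp add: y x_def)
    show "c * sqrt M *\<^sub>R (1 - y) = sqrt M *\<^sub>R (1 - y) * c" if "c * a = a * c" for c
      using y(3)[of c] that by (simp add: x_def algebra_simps)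
    have "sqrt M *\<^sub>R 1 - sqrt M *\<^sub>R (1 - y) = sqrt M *\<^sub>R y" by (simp add: algebra_simps)
    then show "norm (sqrt M *\<^sub>R 1 - sqrt M *\<^sub>R (1 - y)) \<le> sqrt M"
      using M y(4) by (simp add: mult_left_le)
  qed
qed

lemma sa_squareI_norm:
  "star a = a \<Longrightarrow> norm (M *\<^sub>R 1 - a) \<le> M \<Longrightarrow> sa_square (a::'a::unital_cstar_algebra)"
  by (metis ex_sqrt sa_square_def)

text \<open>A converse of \<open>sa_squareI_norm\<close>. Write \<open>a = g\<^sup>2\<close> and
  \<open>M - a = v\<^sup>2\<close>, the latter because \<open>M - (M - a) = a\<close> has norm at
  most \<open>M\<close>; these roots commute and \<open>v\<^sup>2 + g\<^sup>2 = M\<close>.\<close>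

lemma sa_square_norm_diff:
  fixes a :: "'a::unital_cstar_algebra"
  assumes "sa_square a" "norm a \<le> M"
  shows "norm (M *\<^sub>R 1 - a) \<le> M"
proof -
  obtain g where g: "star g = g" "a = g * g" using assms by (auto simp: sa_square_def)
  have "norm (M *\<^sub>R 1 - (M *\<^sub>R 1 - a)) \<le> M" using assms(2) by simp
  moreover have "star (M *\<^sub>R 1 - a) = M *\<^sub>R 1 - a"
    using sa_square_star[OF assms(1)] by (simp add: star_diff star_scaleR)
  ultimately obtain v where v: "star v = v" "M *\<^sub>R 1 - a = v * v"
    "\<And>c. c * (M *\<^sub>R 1 - a) = (M *\<^sub>R 1 - a) * c \<Longrightarrow> c * v = v * c"
    using ex_sqrt by metis
  have "g * v = v * g" by (rule v(3)) (simp add: g algebra_simps)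
  moreover have "v * v + g * g = M *\<^sub>R 1" using v(2) g(2) by (simp add: algebra_simps)
  ultimately show ?thesis
    using norm_le_of_commuting_squares[of v g M] order_trans[OF norm_ge_zero assms(2)] v(1,2) g
    by simp
qed

text \<open>By the norm criterion this is the triangle inequality.\<close>

lemma sa_square_add:
  fixes a b :: "'a::unital_cstar_algebra"
  assumes "sa_square a" "sa_square b"
  shows "sa_square (a + b)"
proof (rule sa_squareI_norm)
  have "norm ((norm a *\<^sub>R 1 - a) + (norm b *\<^sub>R 1 - b)) \<le> norm a + norm b"
    using assms by (intro norm_triangle_mono sa_square_norm_diff) auto
  then show "norm ((norm a + norm b) *\<^sub>R 1 - (a + b)) \<le> norm a + norm b"
    by (simp add: algebra_simps)
qed (use assms in \<open>auto simp: star_add sa_square_star\<close>)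

text \<open>For a common norm bound \<open>M\<close> of the sequence, the norm criterion is a closed
  condition.\<close>

lemma sa_square_limit:
  fixes a :: "nat \<Rightarrow> 'a::unital_cstar_algebra"
  assumes "\<And>n. sa_square (a n)" "a \<longlonglongrightarrow> l"
  shows "sa_square l"
proof -
  obtain M where M: "\<And>n. norm (a n) \<le> M"
    using convergent_imp_Bseq[of a] assms(2) unfolding convergent_def Bseq_def by blast
  show ?thesis
  proof (rule sa_squareI_norm)
    show "star l = l"
      using bounded_linear.tendsto[OF bounded_linear_star assms(2)]
      unfolding sa_square_star[OF assms(1)] by (rule LIMSEQ_unique[OF _ assms(2)])
    have "(\<lambda>n. norm (M *\<^sub>R 1 - a n)) \<longlonglongrightarrow> norm (M *\<^sub>R 1 - l)"
      by (intro tendsto_intros assms)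
    then show "norm (M *\<^sub>R 1 - l) \<le> M"
      by (rule Lim_bounded[where M = 0]) (auto intro: sa_square_norm_diff assms M)
  qed
qed

section \<open>Invertibility and positive elements\<close>

definition invertible_elt :: "'a::monoid_mult \<Rightarrow> bool" where
  "invertible_elt a \<longleftrightarrow> (\<exists>b. a * b = 1 \<and> b * a = 1)"

lemma invertible_one_minus_swap:
  fixes x y :: "'a::{ring,monoid_mult}"
  assumes "invertible_elt (1 - x * y)"
  shows "invertible_elt (1 - y * x)"
proof -
  obtain c where c: "(1 - x * y) * c = 1" "c * (1 - x * y) = 1"
    using assms by (auto simp: invertible_elt_def)
  have 1: "c - x * y * c - 1 = 0" and 2: "c - c * x * y - 1 = 0"
    using c by (simp_all add: left_diff_distrib right_diff_distrib mult.assoc)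
  \<comment> \<open>If \<open>c\<close> inverts \<open>1 - x y\<close>, then
    \<open>1 + y c x\<close> inverts \<open>1 - y x\<close>.\<close>
  have "(1 - y * x) * (1 + y * c * x) = 1 + y * (c - x * y * c - 1) * x"
    by (simp add: algebra_simps)
  moreover have "(1 + y * c * x) * (1 - y * x) = 1 + y * (c - c * x * y - 1) * x"
    by (simp add: algebra_simps)
  ultimately show ?thesis
    unfolding invertible_elt_def 1 2 by (intro exI[of _ "1 + y * c * x"]) simp
qed

text \<open>If \<open>norm p = 1\<close> and \<open>1 - p = k\<^sup>2\<close> has an inverse \<open>c\<close> of norm \<open>m\<close>, then
  \<open>1 - p - 1/m = k\<^sup>2 (1 - c/m)\<close> is again a square, which forces \<open>norm p \<le> 1 - 1/m\<close>.\<close>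

lemma sa_square_norm_not_invertible:
  fixes p :: "'a::unital_cstar_algebra"
  assumes "sa_square p" "norm p = 1"
  shows "\<not> invertible_elt (1 - p)"
proof
  assume "invertible_elt (1 - p)"
  then obtain c where c: "(1 - p) * c = 1" "c * (1 - p) = 1"
    by (auto simp: invertible_elt_def)
  have sp: "star p = p" using assms(1) by (rule sa_square_star)
  obtain g where g: "star g = g" "p = g * g" using assms by (auto simp: sa_square_def)
  have sq: "star (1 - p) = 1 - p" "norm (1 *\<^sub>R 1 - (1 - p)) \<le> 1"
    by (simp_all add: star_diff sp assms(2))
  obtain k where k: "star k = k" "1 - p = k * k" "\<And>d. d * (1 - p) = (1 - p) * d \<Longrightarrow> d * k = k * d"
    using ex_sqrt[OF sq] by metis
  have c_comm: "d * c = c * d" if "d * (1 - p) = (1 - p) * d" for d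
  proof -
    have "d * c = c * (1 - p) * d * c" using c by simp
    also have "\<dots> = c * d * ((1 - p) * c)" by (metis that mult.assoc)
    finally show ?thesis using c by simp
  qed
  have kc: "k * c = c * k" by (rule c_comm) (simp add: k(2) mult.assoc)
  have sc: "star c = c"
  proof -
    have "star c * (1 - p) = 1" using arg_cong[OF c(1), of star] by (simp add: star_mult star_diff sp)
    then have "star c * ((1 - p) * c) = c" by (simp flip: mult.assoc)
    then show ?thesis using c by simp
  qed
  have sq_c: "sa_square c"
  proof -
    have "c = (k * c) * (k * c)" using c by (metis k(2) kc mult.assoc mult_1_right)
    moreover have "star (k * c) = k * c" using kc by (simp add: star_mult sc k(1))
    ultimately show ?thesis using sa_squareI by metis
  qed
  define m where "m = norm c"
  have "c \<noteq> 0"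
  proof
    assume "c = 0"
    then have "p = p * 0" using c(1) by (metis mult_1_right mult_zero_right)
    then show False using assms(2) by simp
  qed
  then have m: "m > 0" by (simp add: m_def)
  have cm: "star (1 - (1/m) *\<^sub>R c) = 1 - (1/m) *\<^sub>R c" "norm (1 *\<^sub>R 1 - (1 - (1/m) *\<^sub>R c)) \<le> 1"
    using m by (simp_all add: star_diff star_scaleR sc m_def)
  obtain w where w: "star w = w" "1 - (1/m) *\<^sub>R c = w * w"
    "\<And>d. d * (1 - (1/m) *\<^sub>R c) = (1 - (1/m) *\<^sub>R c) * d \<Longrightarrow> d * w = w * d"
    using ex_sqrt[OF cm] by metis
  have kw: "k * w = w * k" by (rule w(3)) (simp add: algebra_simps kc)
  have "g * (1 - p) = (1 - p) * g" by (simp add: g algebra_simps)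
  then have gk: "g * k = k * g" and gc: "g * c = c * g" by (rule k(3), rule c_comm)
  have gw: "g * w = w * g" by (rule w(3)) (simp add: algebra_simps gc)
  have "(k * w) * (k * w) = (1 - p) * (1 - (1/m) *\<^sub>R c)"
    unfolding k(2) w(2) by (metis kw mult.assoc)
  also have "\<dots> = (1 - 1/m) *\<^sub>R 1 - p"
    unfolding right_diff_distrib[of "1 - p"] mult_scaleR_right c(1) by (simp add: algebra_simps)
  finally have kwkw: "g * g + (k * w) * (k * w) = (1 - 1/m) *\<^sub>R 1" by (simp add: g)
  \<comment> \<open>This keeps \<open>1 - 1/m\<close> nonnegative, as the bound for commuting
    squares requires.\<close>
  have "m \<ge> 1"
  proof -
    have "norm (1::'a) \<le> norm (1 - p) * m" using norm_mult_ineq[of "1 - p" c] c(1) by (simp add: m_def)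
    moreover have "norm (1 - p) \<le> 1" using sa_square_norm_diff[OF assms(1), of 1] assms(2) by simp
    moreover have "norm (1::'a) \<ge> 1"
      using norm_mult_ineq[of p 1] assms(2) by simp
    ultimately show ?thesis using mult_right_mono[of "norm (1 - p)" 1 m] m by linarith
  qed
  then have m1: "0 \<le> 1 - 1/m" by simp
  have "star (k * w) = k * w" by (simp add: star_mult k(1) w(1) kw)
  moreover have "g * (k * w) = (k * w) * g" using gk gw by (metis mult.assoc)
  ultimately have "norm (g * g) \<le> 1 - 1/m"
    using norm_le_of_commuting_squares[OF g(1) _ _ kwkw m1] by blast
  then have "1 / m \<le> 0" using assms(2) by (simp flip: g(2))
  then show False using m by (simp add: field_simps)
qed

text \<open>The contractions \<open>x \<mapsto> 1 + q x\<close> and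
  \<open>x \<mapsto> 1 + x q\<close> have fixed points, which are a right and a left inverse and
  therefore agree.\<close>

lemma invertible_one_minus:
  fixes q :: "'a::unital_cstar_algebra"
  assumes "norm q < 1"
  shows "invertible_elt (1 - q)"
proof -
  have "dist (1 + q * x) (1 + q * y) \<le> norm q * dist x y" for x y
    by (simp add: dist_norm norm_mult_ineq flip: right_diff_distrib)
  then obtain b where b: "1 + q * b = b"
    using banach_fix_type[of "norm q" "\<lambda>x. 1 + q * x"] assms by auto
  have "dist (1 + x * q) (1 + y * q) \<le> norm q * dist x y" for x y
    by (subst mult.commute) (simp add: dist_norm norm_mult_ineq flip: left_diff_distrib)
  then obtain c where c: "1 + c * q = c"
    using banach_fix_type[of "norm q" "\<lambda>x. 1 + x * q"] assms by auto
  have 1: "(1 - q) * b = 1" and 2: "c * (1 - q) = 1"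
    using b c by (simp_all add: algebra_simps)
  have "c = c * ((1 - q) * b)" using 1 by simp
  also have "\<dots> = b" using 2 by (simp flip: mult.assoc)
  finally show ?thesis using 1 2 by (auto simp: invertible_elt_def)
qed

lemma invertible_one_plus_sa_square:
  fixes a :: "'a::unital_cstar_algebra"
  assumes "sa_square a"
  shows "invertible_elt (1 + a)"
proof -
  define M where "M = norm a"
  \<comment> \<open>Chosen so that \<open>1 + a = (M + 1) (1 - q)\<close>, with
    \<open>norm q \<le> M / (M + 1)\<close>.\<close>
  define q where "q = (1 / (M + 1)) *\<^sub>R (M *\<^sub>R 1 - a)"
  have M: "M \<ge> 0" by (simp add: M_def)
  have "norm (M *\<^sub>R 1 - a) \<le> M" using assms by (simp add: M_def sa_square_norm_diff)
  then have "norm q < 1"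
    using M by (simp add: q_def divide_simps)
  then obtain b where b: "(1 - q) * b = 1" "b * (1 - q) = 1"
    using invertible_one_minus by (auto simp: invertible_elt_def)
  have "(M + 1) *\<^sub>R (1 - q) = (M + 1) *\<^sub>R 1 - (M *\<^sub>R 1 - a)"
    using M by (simp add: q_def scaleR_diff_right)
  then have *: "1 + a = (M + 1) *\<^sub>R (1 - q)" by (simp add: algebra_simps)
  show ?thesis
    unfolding invertible_elt_def *
    by (rule exI[of _ "(1 / (M + 1)) *\<^sub>R b"]) (use b M in simp)
qed

text \<open>With \<open>h = x\<^sup>* x\<close>, \<open>r = \<bar>h\<bar>\<close> and \<open>n = r - h\<close> (twice the negative part of \<open>h\<close>), the element
  \<open>y = x n\<close> satisfies \<open>y\<^sup>* y = - n r n\<close>.  Since \<open>y y\<^sup>* + y\<^sup>* y\<close> is a sum of two squares, \<open>y y\<^sup>*\<close> is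
  positive; as \<open>y y\<^sup>*\<close> and \<open>y\<^sup>* y\<close> have the same nonzero spectrum, both vanish.\<close>

theorem sa_square_star_mult:
  fixes x :: "'a::unital_cstar_algebra"
  shows "sa_square (star x * x)"
proof -
  define h where "h = star x * x"
  have sh: "star h = h" by (simp add: h_def star_mult star_star)
  have hh: "sa_square (h * h)" using sh by (rule sa_squareI)
  obtain r where r: "star r = r" "h * h = r * r" "\<And>c. c * (h * h) = h * h * c \<Longrightarrow> c * r = r * c"
    and r': "norm (sqrt (norm (h * h)) *\<^sub>R 1 - r) \<le> sqrt (norm (h * h))"
    using ex_sqrt[OF sa_square_star[OF hh] sa_square_norm_diff[OF hh order_refl]] by metis
  have hr: "h * r = r * h" by (rule r(3)) (simp add: mult.assoc)
  have sqr: "sa_square r" using r(1) r' by (rule sa_squareI_norm)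
  obtain s where s: "star s = s" "r = s * s" "\<And>c. c * r = r * c \<Longrightarrow> c * s = s * c"
    using ex_sqrt[OF r(1) r'] by metis
  define n where "n = r - h"
  have sn: "star n = n" by (simp add: n_def star_diff r sh)
  have nr: "n * r = r * n" by (simp add: n_def algebra_simps hr)
  have ns: "n * s = s * n" using nr by (rule s(3))
  have nh: "n * h = - (r * n)" by (simp add: n_def algebra_simps hr r(2))
  \<comment> \<open>As \<open>s\<close> is a root of \<open>r\<close> commuting with
    \<open>n\<close>, \<open>g\<^sup>2 = n r n\<close>.\<close>
  define g where "g = n * s"
  have sg: "star g = g" by (simp add: g_def star_mult sn s ns)
  define y where "y = x * n"
  have "star y * y = n * h * n" by (simp add: y_def h_def star_mult sn mult.assoc)
  then have yy: "star y * y = - (g * g)"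
    by (simp add: nh g_def s(2), metis ns mult.assoc)
  \<comment> \<open>\<open>?u\<close> and \<open>?v\<close> are twice the squares of the real and
    imaginary parts of \<open>y\<close>, and add up to
    \<open>y y\<^sup>* + y\<^sup>* y\<close>.\<close>
  have *: "sa_square ((1/2) *\<^sub>R ((y + star y) * (y + star y)))" (is "sa_square ?u")
    by (intro sa_square_scaleR sa_squareI) (simp_all add: star_add star_star add.commute)
  have **: "sa_square ((1/2) *\<^sub>R ((\<i> *\<^sub>C (y - star y)) * (\<i> *\<^sub>C (y - star y))))" (is "sa_square ?v")
  proof (intro sa_square_scaleR sa_squareI)
    have "(- \<i>) *\<^sub>C z = - (\<i> *\<^sub>C z)" for z :: 'a
      using scaleC_scaleC[of \<i> "- 1" z] scaleC_of_real[of "- 1" z]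
      by (simp add: scaleC_uminus_right)
    then show "star (\<i> *\<^sub>C (y - star y)) = \<i> *\<^sub>C (y - star y)"
      by (simp add: star_scaleC star_diff star_star flip: scaleC_uminus_right)
  qed simp
  have i2: "\<i> *\<^sub>C z * \<i> *\<^sub>C z = - (z * z)" for z :: 'a
    using scaleC_of_real[of "- 1" "z * z"]
    by (simp add: mult_scaleC_left mult_scaleC_right scaleC_scaleC)
  have "?u + ?v = (1/2) *\<^sub>R ((y * star y + star y * y) + (y * star y + star y * y))"
    unfolding i2 scaleR_add_right[symmetric] by (simp add: algebra_simps)
  then have "?u + ?v = y * star y + star y * y"
    by (simp only: scaleR_half_double)
  then have "y * star y = ?u + ?v + g * g" by (simp add: yy)
  then have "sa_square (y * star y)"
    using * ** sg by (auto intro: sa_square_add sa_squareI)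
  then have inv: "invertible_elt (1 - l *\<^sub>R (g * g))" if "l \<ge> 0" for l
  proof -
    \<comment> \<open>Exchanging the factors \<open>- l y\<close> and \<open>y\<^sup>*\<close>
      carries invertibility over to \<open>1 + l y\<^sup>* y\<close>, where
      \<open>y\<^sup>* y = - g\<^sup>2\<close>.\<close>
    have "invertible_elt (1 - (- l *\<^sub>R y) * star y)"
      using invertible_one_plus_sa_square[OF sa_square_scaleR[OF \<open>sa_square (y * star y)\<close> that]] by simp
    from invertible_one_minus_swap[OF this] show ?thesis by (simp add: yy)
  qed
  have "g * g = 0"
  proof (rule ccontr)
    assume nz: "g * g \<noteq> 0"
    have "sa_square ((1 / norm (g * g)) *\<^sub>R (g * g))"
      by (intro sa_square_scaleR sa_squareI sg) simp
    then show False
      using sa_square_norm_not_invertible[of "(1 / norm (g * g)) *\<^sub>R (g * g)"] nz inv by simp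
  qed
  \<comment> \<open>Subtracting gives \<open>n\<^sup>3 = 0\<close>; a self-adjoint nilpotent element
    is 0, so \<open>h = r\<close>.\<close>
  then have "n * r * n = 0" and "n * h * n = 0"
    using yy \<open>star y * y = n * h * n\<close> nh nr by auto
  then have "n * (r - h) * n = 0" by (simp add: algebra_simps)
  then have "(n * n) * (n * n) = 0" by (simp add: mult.assoc flip: n_def)
  then have "norm ((n * n) * (n * n)) = 0" by simp
  then have "n = 0"
    by (simp add: norm_square_selfadj star_mult sn)
  then show ?thesis using sqr by (simp add: n_def flip: h_def)
qed

section \<open>The order given by positive elements\<close>

lemma positive_element_iff_sa_square: "positive_element a \<longleftrightarrow> sa_square a"
  unfolding positive_element_def using sa_square_star_mult by (metis sa_square_def)

lemma sa_square_conjugate: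
  assumes "sa_square a"
  shows "sa_square (b * a * star b)"
proof -
  obtain h where h: "star h = h" "a = h * h" using assms by (auto simp: sa_square_def)
  have "b * a * star b = star (h * star b) * (h * star b)"
    by (simp add: h star_mult star_star mult.assoc)
  then show ?thesis using sa_square_star_mult by metis
qed

lemma sa_square_sum: "(\<And>i. i \<in> I \<Longrightarrow> sa_square (f i)) \<Longrightarrow> sa_square (\<Sum>i\<in>I. f i)"
  using sa_square_scaleR_one[of 0]
  by (induction I rule: infinite_finite_induct) (auto intro: sa_square_add)

text \<open>If \<open>t - h = u\<^sup>2\<close> and \<open>t + h = v\<^sup>2\<close> with roots
  commuting with \<open>h\<close> and each other, then
  \<open>h\<^sup>2 + (u v)\<^sup>2 = t\<^sup>2\<close>.\<close>

lemma norm_le_of_two_sided: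
  fixes h :: "'a::unital_cstar_algebra"
  assumes "sa_square (t *\<^sub>R 1 - h)" "sa_square (t *\<^sub>R 1 + h)" "0 \<le> t"
  shows "norm h \<le> t"
proof -
  have sh: "star h = h" using sa_square_star[OF assms(1)] by (simp add: star_diff star_scaleR)
  obtain u where u: "star u = u" "t *\<^sub>R 1 - h = u * u"
    "\<And>c. c * (t *\<^sub>R 1 - h) = (t *\<^sub>R 1 - h) * c \<Longrightarrow> c * u = u * c"
    using ex_sqrt[OF sa_square_star[OF assms(1)] sa_square_norm_diff[OF assms(1) order_refl]] by metis
  obtain v where v: "star v = v" "t *\<^sub>R 1 + h = v * v"
    "\<And>c. c * (t *\<^sub>R 1 + h) = (t *\<^sub>R 1 + h) * c \<Longrightarrow> c * v = v * c"
    using ex_sqrt[OF sa_square_star[OF assms(2)] sa_square_norm_diff[OF assms(2) order_refl]] by metis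
  have hu: "h * u = u * h" by (rule u(3)) (simp add: algebra_simps)
  have hv: "h * v = v * h" by (rule v(3)) (simp add: algebra_simps)
  have uv: "u * v = v * u" by (rule v(3)) (simp add: algebra_simps hu)
  have "(u * v) * (u * v) = (u * u) * (v * v)" by (metis uv mult.assoc)
  also have "\<dots> = (t * t) *\<^sub>R 1 - h * h" by (simp add: algebra_simps flip: u(2) v(2))
  finally have *: "h * h + (u * v) * (u * v) = (t * t) *\<^sub>R 1" by simp
  have "star (u * v) = u * v" by (simp add: star_mult u(1) v(1) uv)
  moreover have "h * (u * v) = (u * v) * h" by (metis hu hv mult.assoc)
  ultimately have "norm (h * h) \<le> t * t"
    using sh * assms(3) by (intro norm_le_of_commuting_squares) auto
  then show ?thesis
    using power2_le_imp_le[of "norm h" t] assms(3)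
    by (simp add: norm_square_selfadj[OF sh] power2_eq_square)
qed

section \<open>Sums of commutators from a contracting family\<close>

text \<open>Since \<open>T x = \<Sum>i b\<^sub>i x b\<^sub>i\<^sup>*\<close> is positive and \<open>T 1\<close> has norm \<open>< 1\<close>, \<open>T\<close> is a strict contraction
  on self-adjoint elements, so that \<open>c = a + T c\<close> has a positive solution for positive \<open>a\<close>.\<close>

lemma ex_positive_fixpoint:
  fixes b :: "nat \<Rightarrow> 'a::unital_cstar_algebra"
  assumes T1: "norm (\<Sum>i\<in>I. b i * star (b i)) < 1" and a: "sa_square a"
  obtains c where "sa_square c" "c = a + (\<Sum>i\<in>I. b i * c * star (b i))"
proof -
  define T where "T x = (\<Sum>i\<in>I. b i * x * star (b i))" for x
  define s where "s = T 1"
  define r where "r = norm s"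
  have r: "r < 1" "0 \<le> r" using T1 by (simp_all add: r_def s_def T_def)
  have T_pos: "sa_square (T x)" if "sa_square x" for x
    unfolding T_def by (intro sa_square_sum sa_square_conjugate that)
  have T_diff: "T (x - y) = T x - T y" and T_add: "T (x + y) = T x + T y" for x y
    by (simp_all add: T_def algebra_simps sum.distrib sum_subtractf)
  have T_scale: "T (t *\<^sub>R x) = t *\<^sub>R T x" for t x
    by (simp add: T_def scaleR_sum_right)
  have s: "sa_square s" unfolding s_def using sa_square_scaleR_one[of 1] by (intro T_pos) simp
  have rs: "sa_square (r *\<^sub>R 1 - s)"
    by (rule sa_squareI_norm[of _ r]) (simp_all add: star_diff star_scaleR sa_square_star[OF s] r_def)
  \<comment> \<open>\<open>r m - T x\<close> is the sum of the positive elements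
    \<open>m (r - T 1)\<close> and \<open>T (m - x)\<close>.\<close>
  have T_bound: "sa_square ((r * m) *\<^sub>R 1 - T x)" if "sa_square (m *\<^sub>R 1 - x)" "0 \<le> m" for m x
  proof -
    have "sa_square (m *\<^sub>R (r *\<^sub>R 1 - s) + T (m *\<^sub>R 1 - x))"
      using that rs by (intro sa_square_add sa_square_scaleR T_pos)
    moreover have "m *\<^sub>R (r *\<^sub>R 1 - s) + T (m *\<^sub>R 1 - x) = (r * m) *\<^sub>R 1 - T x"
      by (simp add: T_diff T_scale algebra_simps flip: s_def)
    ultimately show ?thesis by simp
  qed
  have T_norm: "norm (T x) \<le> r * norm x" if sx: "star x = x" for x
  proof (rule norm_le_of_two_sided)
    have "sa_square (norm x *\<^sub>R 1 - x)" "sa_square (norm x *\<^sub>R 1 - (- x))"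
      by (rule sa_squareI_norm[of _ "norm x"], simp_all add: star_add star_diff star_scaleR sx)+
    from this[THEN T_bound] show "sa_square ((r * norm x) *\<^sub>R 1 - T x)"
      "sa_square ((r * norm x) *\<^sub>R 1 + T x)"
      using T_scale[of "- 1" x] by simp_all
  qed (use r in simp)
  \<comment> \<open>Banach's theorem is applied on the closed cone of positive elements, which keeps
    the solution positive.\<close>
  have "closed {x :: 'a. sa_square x}"
    unfolding closed_sequential_limits by (auto intro: sa_square_limit)
  then have "complete {x :: 'a. sa_square x}" by (simp add: complete_eq_closed)
  moreover have "{x :: 'a. sa_square x} \<noteq> {}" using a by auto
  moreover have "(\<lambda>x. a + T x) ` {x. sa_square x} \<subseteq> {x. sa_square x}"
    using a by (auto intro: sa_square_add T_pos)
  moreover have "dist (a + T x) (a + T y) \<le> r * dist x y"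
    if "x \<in> {x. sa_square x}" "y \<in> {x. sa_square x}" for x y
    using T_norm[of "x - y"] that by (simp add: dist_norm star_diff sa_square_star T_diff)
  ultimately have "\<exists>!c\<in>{x. sa_square x}. a + T c = c"
    using r by (intro Banach_fix) auto
  then obtain c where "sa_square c" "a + T c = c" by auto
  then show thesis using that[of c] by (simp add: T_def)
qed

lemma positive_eq_sum_sa_commutators:
  fixes b :: "nat \<Rightarrow> 'a::unital_cstar_algebra"
  assumes "(\<Sum>i\<in>I. star (b i) * b i) = 1" "norm (\<Sum>i\<in>I. b i * star (b i)) < 1" "sa_square a"
  obtains x :: "nat \<Rightarrow> 'a" where "a = (\<Sum>i\<in>I. commutator (star (x i)) (x i))"
proof -
  obtain c where c: "sa_square c" "c = a + (\<Sum>i\<in>I. b i * c * star (b i))"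
    using ex_positive_fixpoint[OF assms(2,3)] by blast
  obtain d where d: "star d = d" "c = d * d" using c(1) by (auto simp: sa_square_def)
  \<comment> \<open>The unit, written as a sum, is inserted between the two factors of
    \<open>c = d d\<close>.\<close>
  have "c = d * (\<Sum>i\<in>I. star (b i) * b i) * d" by (simp add: assms d)
  also have "\<dots> = (\<Sum>i\<in>I. d * (star (b i) * b i) * d)"
    by (simp add: sum_distrib_left sum_distrib_right)
  finally have "a = (\<Sum>i\<in>I. d * (star (b i) * b i) * d) - (\<Sum>i\<in>I. b i * c * star (b i))"
    using c(2) by (simp add: eq_diff_eq)
  also have "\<dots> = (\<Sum>i\<in>I. commutator (star (b i * d)) (b i * d))"
    by (simp add: commutator_def star_mult d mult.assoc sum_subtractf)
  finally show thesis by (rule that)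
qed

lemma eq_positive_combination:
  fixes a :: "'a::unital_cstar_algebra"
  obtains p q p' q' where "sa_square p" "sa_square q" "sa_square p'" "sa_square q'"
    "a = p - q + \<i> *\<^sub>C (p' - q')"
proof -
  have sa: "\<exists>p q. sa_square p \<and> sa_square q \<and> h = p - q" if "star h = h" for h :: 'a
  proof (intro exI conjI)
    show "sa_square (norm h *\<^sub>R 1 + h)"
      by (rule sa_squareI_norm[of _ "norm h"]) (simp_all add: star_add star_scaleR that)
    show "sa_square (norm h *\<^sub>R (1::'a))" by (rule sa_square_scaleR_one) simp
  qed simp
  have neg: "(- c) *\<^sub>C x = - (c *\<^sub>C x)" for c and x :: 'a
    using scaleC_scaleC[of c "- 1" x] scaleC_of_real[of "- 1" x] by (simp add: scaleC_uminus_right)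
  define u where "u = (1/2) *\<^sub>R (a + star a)"
  define v where "v = (1/2) *\<^sub>R ((- \<i>) *\<^sub>C (a - star a))"
  have "star u = u" by (simp add: u_def star_scaleR star_add star_star add.commute)
  moreover have "star v = v"
    by (simp add: v_def star_scaleR star_scaleC star_diff star_star neg flip: scaleC_uminus_right)
  moreover have "a = u + \<i> *\<^sub>C v"
  proof -
    have "\<i> *\<^sub>C v = (1/2) *\<^sub>R (a - star a)"
      using scaleC_of_real[of "1/2" "a - star a"]
      unfolding v_def by (simp add: scaleC_scaleC flip: scaleC_of_real)
    then have "u + \<i> *\<^sub>C v = (1/2) *\<^sub>R (a + a)" by (simp add: u_def flip: scaleR_add_right)
    then show ?thesis by (simp add: scaleR_half_double)
  qed
  ultimately show thesis using sa that by metis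
qed

text \<open>The equation \<open>c = a + T c\<close> has been solved for positive \<open>a\<close>;
  splitting \<open>a\<close> into four positive parts and linearity of \<open>T\<close> give the
  general case.\<close>

lemma eq_sum_commutators:
  fixes b :: "nat \<Rightarrow> 'a::unital_cstar_algebra" and a :: 'a
  assumes "(\<Sum>i\<in>I. star (b i) * b i) = 1" "norm (\<Sum>i\<in>I. b i * star (b i)) < 1"
  obtains x y :: "nat \<Rightarrow> 'a" where "a = (\<Sum>i\<in>I. commutator (x i) (y i))"
proof -
  define T where "T x = (\<Sum>i\<in>I. b i * x * star (b i))" for x
  have T_diff: "T (x - y) = T x - T y" and T_add: "T (x + y) = T x + T y" for x y
    by (simp_all add: T_def algebra_simps sum.distrib sum_subtractf)
  have scaleC_sum: "k *\<^sub>C sum f I = (\<Sum>i\<in>I. k *\<^sub>C f i)" for k and f :: "nat \<Rightarrow> 'a"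
    using scaleC_add_right[of k "0::'a" 0]
    by (induction I rule: infinite_finite_induct) (auto simp: scaleC_add_right)
  have T_scale: "T (k *\<^sub>C x) = k *\<^sub>C T x" for k x
    by (simp add: T_def scaleC_sum mult_scaleC_left mult_scaleC_right)
  have fixp: "\<exists>c. c = p + T c" if "sa_square p" for p :: 'a
    using ex_positive_fixpoint[OF assms(2) that] unfolding T_def by metis
  obtain p q p' q' where pq: "sa_square p" "sa_square q" "sa_square p'" "sa_square q'"
    "a = p - q + \<i> *\<^sub>C (p' - q')" by (rule eq_positive_combination)
  obtain c d c' d' where cd: "c = p + T c" "d = q + T d" "c' = p' + T c'" "d' = q' + T d'"
    using pq fixp by metis
  define e where "e = c - d + \<i> *\<^sub>C (c' - d')"
  have "a = e - T e"
  proof -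
    have "p = c - T c" "q = d - T d" "p' = c' - T c'" "q' = d' - T d'"
      using cd by (simp_all add: algebra_simps)
    then have "p - q = (c - d) - T (c - d)" "p' - q' = (c' - d') + - T (c' - d')"
      by (simp_all add: T_diff)
    then show ?thesis
      unfolding pq(5) e_def T_add T_scale by (simp only: scaleC_add_right scaleC_uminus_right) simp
  qed
  also have "\<dots> = (\<Sum>i\<in>I. star (b i) * b i) * e - T e" by (simp add: assms)
  also have "\<dots> = (\<Sum>i\<in>I. commutator (star (b i)) (b i * e))"
    by (simp add: commutator_def T_def sum_distrib_right mult.assoc sum_subtractf)
  finally show thesis by (rule that)
qed

section \<open>Tracial states and contracting families\<close>

text \<open>Both \<open>s\<close> and \<open>norm s - s\<close> are positive, so
  \<open>\<tau> s\<close> lies between 0 and \<open>norm s\<close>.\<close>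

lemma state_norm_bound:
  fixes \<tau> :: "'a::unital_cstar_algebra \<Rightarrow> complex"
  assumes "state \<tau>" "sa_square s"
  shows "cmod (\<tau> s) \<le> norm s"
proof -
  have pos: "\<tau> p \<in> \<real>\<^sub>\<ge>\<^sub>0" if "sa_square p" for p
    using assms(1) that by (simp add: state_def positive_functional_def positive_element_iff_sa_square)
  have lin: "\<tau> (x + y) = \<tau> x + \<tau> y" "\<tau> (c *\<^sub>C x) = c * \<tau> x" for x y c
    using assms(1) by (simp_all add: state_def positive_functional_def complex_linear_functional_def)
  have scaleR: "\<tau> (t *\<^sub>R x) = of_real t * \<tau> x" for t x
    by (simp flip: scaleC_of_real add: lin)
  have "sa_square (norm s *\<^sub>R 1 - s)"
    by (rule sa_squareI_norm[of _ "norm s"])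
      (simp_all add: star_diff star_scaleR sa_square_star[OF assms(2)])
  from pos[OF this] have "of_real (norm s) - \<tau> s \<in> \<real>\<^sub>\<ge>\<^sub>0"
    using lin(1)[of "norm s *\<^sub>R 1 - s" s] assms(1) by (simp add: scaleR state_def)
  with pos[OF assms(2)] show ?thesis
    by (auto simp: complex_nonneg_Reals_iff cmod_eq_Re)
qed

lemma tracial_state_add: "tracial_state \<tau> \<Longrightarrow> \<tau> (x + y) = \<tau> x + \<tau> y"
  by (simp add: tracial_state_def state_def positive_functional_def complex_linear_functional_def)

lemma tracial_state_sum:
  assumes "tracial_state \<tau>"
  shows "\<tau> (sum f I) = (\<Sum>i\<in>I. \<tau> (f i))"
proof -
  have "\<tau> 0 = 0" using tracial_state_add[OF assms, of 0 0] by simp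
  then show ?thesis
    by (induction I rule: infinite_finite_induct) (auto simp: tracial_state_add[OF assms])
qed

text \<open>A trace would take the value 1 on both sums, exceeding the norm of the second.\<close>

lemma no_tracial_state_if_contracting:
  fixes b :: "nat \<Rightarrow> 'a::unital_cstar_algebra"
    and \<tau> :: "'a \<Rightarrow> complex"
  assumes "(\<Sum>i\<in>I. star (b i) * b i) = 1" "norm (\<Sum>i\<in>I. b i * star (b i)) < 1"
  shows "\<not> tracial_state \<tau>"
proof
  assume \<tau>: "tracial_state \<tau>"
  have "sa_square (\<Sum>i\<in>I. b i * star (b i))"
    using sa_square_star_mult[of "star (b _)"] by (intro sa_square_sum) (simp add: star_star)
  moreover have "\<tau> (\<Sum>i\<in>I. b i * star (b i)) = \<tau> (\<Sum>i\<in>I. star (b i) * b i)"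
    unfolding tracial_state_sum[OF \<tau>] using \<tau> by (intro sum.cong) (auto simp: tracial_state_def)
  then have "\<tau> (\<Sum>i\<in>I. b i * star (b i)) = 1"
    using \<tau> assms(1) by (simp add: tracial_state_def state_def)
  ultimately show False
    using state_norm_bound[of \<tau> "\<Sum>i\<in>I. b i * star (b i)"] \<tau> assms(2)
    by (simp add: tracial_state_def)
qed

text \<open>Scalars are absorbed by square roots, and signs by
  \<open>- [v\<^sup>*, v] = [v, v\<^sup>*]\<close>.\<close>

lemma span_sa_commutators:
  fixes z :: "'a::unital_cstar_algebra"
  assumes "z \<in> span (range (\<lambda>x. commutator (star x) x))"
  obtains n and x :: "nat \<Rightarrow> 'a" where "z = (\<Sum>i<n. commutator (star (x i)) (x i))"
proof -
  have "\<exists>n (x :: nat \<Rightarrow> 'a). z = (\<Sum>i<n. commutator (star (x i)) (x i))"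
    using assms
  proof (induction rule: span_induct_alt)
    case base
    show ?case by (intro exI[of _ 0]) simp
  next
    case (step c w y)
    then obtain n and x :: "nat \<Rightarrow> 'a" where x: "y = (\<Sum>i<n. commutator (star (x i)) (x i))" by blast
    obtain v where v: "w = commutator (star v) v" using step by blast
    obtain u where u: "c *\<^sub>R w = commutator (star u) u"
    proof (cases "c \<ge> 0")
      case True
      show thesis
        using True by (intro that[of "sqrt c *\<^sub>R v"])
          (simp_all add: v commutator_def star_scaleR scaleR_diff_right)
    next
      case False
      show thesis
        using False by (intro that[of "sqrt (- c) *\<^sub>R star v"])
          (simp add: v commutator_def star_scaleR star_star scaleR_diff_right)
    qed
    have "(\<Sum>i<n. commutator (star ((x(n := u)) i)) ((x(n := u)) i))
        = (\<Sum>i<n. commutator (star (x i)) (x i))"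
      by (rule sum.cong) auto
    then have "c *\<^sub>R w + y = (\<Sum>i<Suc n. commutator (star ((x(n := u)) i)) ((x(n := u)) i))"
      by (simp add: u x add.commute)
    then show ?case by blast
  qed
  then show thesis using that by blast
qed

text \<open>Writing the commutator sum as \<open>X - Y\<close> with \<open>X = \<Sum> x\<^sub>i\<^sup>* x\<^sub>i\<close> and \<open>Y = \<Sum> x\<^sub>i x\<^sub>i\<^sup>*\<close>, add the square
  of \<open>d = sqrt (M - X)\<close> to both: \<open>X\<close> becomes \<open>M\<close>, and \<open>Y\<close> becomes \<open>M - (X - Y)\<close>.\<close>

lemma contracting_family_if_near_commutators:
  fixes x :: "nat \<Rightarrow> 'a::unital_cstar_algebra"
  assumes "norm (1 - (\<Sum>i<n. commutator (star (x i)) (x i))) < 1"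
  obtains m and b :: "nat \<Rightarrow> 'a" where "m \<ge> 2" "(\<Sum>i=1..m. star (b i) * b i) = 1"
    "norm (\<Sum>i=1..m. b i * star (b i)) < 1"
proof -
  define X where "X = (\<Sum>i<n. star (x i) * x i)"
  define Y where "Y = (\<Sum>i<n. x i * star (x i))"
  define M where "M = max 1 (norm X)"
  have M: "M \<ge> 1" "norm X \<le> M" by (simp_all add: M_def)
  have near: "norm (1 - (X - Y)) < 1"
    using assms by (simp add: X_def Y_def commutator_def sum_subtractf)
  have "sa_square X" unfolding X_def by (intro sa_square_sum sa_square_star_mult)
  then have "star (M *\<^sub>R 1 - X) = M *\<^sub>R 1 - X" by (simp add: star_diff star_scaleR sa_square_star)
  then have "sa_square (M *\<^sub>R 1 - X)" by (rule sa_squareI_norm[of _ M]) (simp add: M)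
  then obtain d where d: "star d = d" "d * d = M *\<^sub>R 1 - X" by (auto simp: sa_square_def)
  \<comment> \<open>The final zero, at index \<open>n + 1\<close>, ensures at least two members even
    if \<open>n = 0\<close>.\<close>
  define c where "c i = (if i < n then x i else if i = n then d else 0)" for i
  define b where "b i = (1 / sqrt M) *\<^sub>R c (i - 1)" for i
  have shift: "(\<Sum>i=1..n + 2. f (i - 1)) = (\<Sum>i<n + 2. f i)" for f :: "nat \<Rightarrow> 'a"
    by (rule sum.reindex_bij_witness[of _ Suc "\<lambda>i. i - 1"]) auto
  have c_sum: "(\<Sum>i<n + 2. f (c i)) = (\<Sum>i<n. f (x i)) + f d + f 0" for f :: "'a \<Rightarrow> 'a"
  proof -
    have "(\<Sum>i<n. f (c i)) = (\<Sum>i<n. f (x i))" by (rule sum.cong) (auto simp: c_def)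
    then show ?thesis by (simp add: c_def numeral_2_eq_2)
  qed
  have sq: "(1 / sqrt M) * (1 / sqrt M) = 1 / M" using M by (simp add: divide_simps)
  have bb: "star (b i) * b i = (1 / M) *\<^sub>R (star (c (i - 1)) * c (i - 1))"
    "b i * star (b i) = (1 / M) *\<^sub>R (c (i - 1) * star (c (i - 1)))" for i
    by (simp_all add: b_def star_scaleR sq[simplified])
  have 1: "(\<Sum>i=1..n + 2. star (b i) * b i) = (1 / M) *\<^sub>R (X + d * d)"
    unfolding bb scaleR_sum_right[symmetric] shift[of "\<lambda>i. star (c i) * c i"]
      c_sum[of "\<lambda>z. star z * z"] by (simp add: X_def d)
  have 2: "(\<Sum>i=1..n + 2. b i * star (b i)) = (1 / M) *\<^sub>R (Y + d * d)"
    unfolding bb scaleR_sum_right[symmetric] shift[of "\<lambda>i. c i * star (c i)"]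
      c_sum[of "\<lambda>z. z * star z"] by (simp add: Y_def d)
  \<comment> \<open>Since \<open>M \<ge> 1\<close>, the first term has norm at most
    \<open>M - 1\<close>; the second has norm below 1.\<close>
  have "Y + d * d = (M - 1) *\<^sub>R 1 + (1 - (X - Y))"
    by (simp add: d algebra_simps)
  then have "norm (Y + d * d) \<le> norm ((M - 1) *\<^sub>R (1::'a)) + norm (1 - (X - Y))"
    by (metis norm_triangle_ineq)
  also have "\<dots> < M" using near norm_scaleR_one_le[of "M - 1", where 'a = 'a] M by linarith
  finally have "norm ((1 / M) *\<^sub>R (Y + d * d)) < 1" using M by (simp add: divide_simps)
  moreover have "(1 / M) *\<^sub>R (X + d * d) = 1" using M by (simp add: d)
  ultimately show thesis
    using that[of "n + 2" b] 1 2 by simp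
qed

lemma le_infdist:
  "V \<noteq> {} \<Longrightarrow> (\<And>v. v \<in> V \<Longrightarrow> m \<le> norm (x - v)) \<Longrightarrow> m \<le> infdist x V"
  by (auto simp: infdist_notempty dist_norm intro!: cINF_greatest)

text \<open>This is the quotient seminorm modulo \<open>V\<close>. A linear functional below it
  vanishes on \<open>V\<close> and is bounded by the norm.\<close>

lemma sublinear_infdist_subspace:
  fixes V :: "'a::real_normed_vector set"
  assumes "subspace V"
  shows "sublinear (\<lambda>x. infdist x V)"
proof -
  have ne: "V \<noteq> {}" using assms subspace_0 by blast
  have lower: "infdist x V \<le> norm (x - v)" if "v \<in> V" for x v
    using infdist_le[OF that, of x] by (simp add: dist_norm)
  have greatest: "m \<le> infdist x V" if "\<And>v. v \<in> V \<Longrightarrow> m \<le> norm (x - v)" for x m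
    using le_infdist[OF ne] that by blast
  show ?thesis
    unfolding sublinear_def
  proof (intro conjI allI impI)
    fix x y :: 'a
    have "infdist (x + y) V - infdist y V \<le> infdist x V"
    proof (rule greatest)
      fix v assume v: "v \<in> V"
      have "infdist (x + y) V - norm (x - v) \<le> infdist y V"
      proof (rule greatest)
        fix w assume "w \<in> V"
        then have "infdist (x + y) V \<le> norm ((x + y) - (v + w))"
          using v assms by (intro lower) (rule subspace_add)
        also have "\<dots> \<le> norm (x - v) + norm (y - w)"
          by (metis add_diff_add norm_triangle_ineq)
        finally show "infdist (x + y) V - norm (x - v) \<le> norm (y - w)" by simp
      qed
      then show "infdist (x + y) V - infdist y V \<le> norm (x - v)" by simp
    qed
    then show "infdist (x + y) V \<le> infdist x V + infdist y V" by simp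
  next
    fix t :: real and x :: 'a
    assume t: "0 < t"
    have "(1 / t) * infdist (t *\<^sub>R x) V \<le> infdist x V"
    proof (rule greatest)
      fix v assume "v \<in> V"
      then have "infdist (t *\<^sub>R x) V \<le> norm (t *\<^sub>R x - t *\<^sub>R v)"
        using assms by (intro lower) (rule subspace_scale)
      also have "\<dots> = t * norm (x - v)" using t by (simp flip: scaleR_diff_right)
      finally show "(1 / t) * infdist (t *\<^sub>R x) V \<le> norm (x - v)"
        using t by (simp add: field_simps)
    qed
    then show "infdist (t *\<^sub>R x) V \<le> t * infdist x V" using t by (simp add: field_simps)
  qed
qed

text \<open>The trace is the complexification \<open>\<psi> x - \<i> \<psi> (\<i> x)\<close> of the hermitian part \<open>\<psi>\<close> of \<open>f\<close>;
  \<open>f\<close> is positive because \<open>norm (1 - a) \<le> 1\<close> for positive \<open>a\<close> of norm at most \<open>1\<close>.\<close>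

lemma tracial_state_of_real_functional:
  fixes f :: "'a::unital_cstar_algebra \<Rightarrow> real"
  assumes f: "linear f" "\<And>x. f x \<le> norm x" "f 1 = 1" "\<And>x. f (commutator (star x) x) = 0"
  shows "\<exists>\<tau> :: 'a \<Rightarrow> complex. tracial_state \<tau>"
proof -
  define \<psi> where "\<psi> x = (f x + f (star x)) / 2" for x
  define \<tau> where "\<tau> x = complex_of_real (\<psi> x) - \<i> * complex_of_real (\<psi> (\<i> *\<^sub>C x))" for x
  note f_simps = linear_add[OF f(1)] linear_diff[OF f(1)] linear_scale[OF f(1)]
  have \<psi>_add: "\<psi> (x + y) = \<psi> x + \<psi> y" for x y
    by (simp add: \<psi>_def f_simps star_add add_divide_distrib)
  have \<psi>_scale: "\<psi> (t *\<^sub>R x) = t * \<psi> x" for t x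
    by (simp add: \<psi>_def f_simps star_scaleR algebra_simps)
  have f_pos: "f a \<ge> 0" if "sa_square a" for a
    using f(2)[of "norm a *\<^sub>R 1 - a"] sa_square_norm_diff[OF that order_refl]
    by (simp add: f_simps f(3))
  have lin: "complex_linear_functional \<tau>"
    unfolding complex_linear_functional_def
  proof (intro conjI allI)
    show "\<tau> (x + y) = \<tau> x + \<tau> y" for x y
      by (simp add: \<tau>_def \<psi>_add scaleC_add_right algebra_simps)
    show "\<tau> (c *\<^sub>C x) = c * \<tau> x" for c x
    proof -
      have 1: "c *\<^sub>C x = Re c *\<^sub>R x + Im c *\<^sub>R (\<i> *\<^sub>C x)" for c and x :: 'a
      proof -
        have "c *\<^sub>C x = (of_real (Re c) + of_real (Im c) * \<i>) *\<^sub>C x"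
          by (metis complex_eq mult.commute)
        then show ?thesis by (simp only: scaleC_add_left scaleC_of_real flip: scaleC_scaleC)
      qed
      have 2: "\<psi> (c *\<^sub>C x) = Re c * \<psi> x + Im c * \<psi> (\<i> *\<^sub>C x)" for c x
        by (subst 1[of c x]) (simp only: \<psi>_add \<psi>_scale)
      show ?thesis
        unfolding \<tau>_def scaleC_scaleC 2[of c] 2[of "\<i> * c"]
        by (simp add: complex_eq_iff algebra_simps)
    qed
  qed
  have real: "\<tau> a = complex_of_real (f a)" if "star a = a" for a
  proof -
    have "star (\<i> *\<^sub>C a) = - (\<i> *\<^sub>C a)"
      using scaleC_scaleC[of \<i> "- 1" a] scaleC_of_real[of "- 1" a]
      by (simp add: star_scaleC that scaleC_uminus_right)
    then show ?thesis by (simp add: \<tau>_def \<psi>_def that linear_neg[OF f(1)])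
  qed
  have \<psi>_trace: "\<psi> (a * b) = \<psi> (b * a)" for a b
  proof -
    \<comment> \<open>Polarization: the cross terms of \<open>[x\<^sup>*, x]\<close> are
      \<open>[a, b]\<close> and its adjoint.\<close>
    define x where "x = star a + b"
    have "commutator (star x) x = commutator (star (star a)) (star a) + commutator (star b) b
        + ((a * b - b * a) + star (a * b - b * a))"
      by (simp add: x_def commutator_def star_add star_diff star_mult star_star algebra_simps)
    then have "f ((a * b - b * a) + star (a * b - b * a)) = 0"
      using f(4) by (metis add_0 linear_add[OF f(1)])
    then show ?thesis by (simp add: \<psi>_def f_simps star_diff)
  qed
  have "tracial_state \<tau>"
    unfolding tracial_state_def state_def positive_functional_def
  proof (intro conjI allI impI lin)
    show "\<tau> a \<in> \<real>\<^sub>\<ge>\<^sub>0" if "positive_element a" for a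
      using that f_pos[of a] by (simp add: positive_element_iff_sa_square real sa_square_star)
    show "\<tau> 1 = 1" by (simp add: real f(3))
    show "\<tau> (a * b) = \<tau> (b * a)" for a b
      using \<psi>_trace[of a b] \<psi>_trace[of "\<i> *\<^sub>C a" b]
      by (simp add: \<tau>_def mult_scaleC_left mult_scaleC_right)
  qed
  then show ?thesis by blast
qed

lemma contracting_family_if_no_tracial_state:
  assumes "\<nexists>\<tau> :: 'a::unital_cstar_algebra \<Rightarrow> complex. tracial_state \<tau>"
  obtains n and b :: "nat \<Rightarrow> 'a::unital_cstar_algebra" where "n \<ge> 2" "(\<Sum>i=1..n. star (b i) * b i) = 1"
    "norm (\<Sum>i=1..n. b i * star (b i)) < 1"
proof -
  define V where "V = span (range (\<lambda>x::'a. commutator (star x) x))"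
  have V: "subspace V" by (simp add: V_def)
  have "\<exists>z\<in>V. norm (1 - z) < 1"
  proof (rule ccontr)
    assume "\<not> ?thesis"
    then have far: "\<And>z. z \<in> V \<Longrightarrow> 1 \<le> norm (1 - z)" by force
    obtain f where f: "linear f" "\<And>x. f x \<le> infdist x V" "f 1 = infdist 1 V"
      using hahn_banach_sublinear[OF sublinear_infdist_subspace[OF V]] by blast
    have "0 \<in> V" using V by (rule subspace_0)
    have le: "infdist x V \<le> norm x" for x
      using infdist_le[OF \<open>0 \<in> V\<close>, of x] by simp
    have "1 \<le> infdist 1 V"
      using far \<open>0 \<in> V\<close> by (intro le_infdist) auto
    then have "f 1 = 1" using f(3) le[of 1] norm_one_le[where 'a = 'a] by linarith
    \<comment> \<open>The distance is 0 at \<open>z\<close> and at \<open>- z\<close>, so neither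
      \<open>f z\<close> nor \<open>- f z\<close> is positive.\<close>
    moreover have "f z = 0" if "z \<in> V" for z
      using f(2)[of z] f(2)[of "- z"] that subspace_neg[OF V that] linear_neg[OF f(1), of z] by simp
    then have "f (commutator (star x) x) = 0" for x
      by (simp add: V_def span_base)
    ultimately have "\<exists>\<tau> :: 'a \<Rightarrow> complex. tracial_state \<tau>"
      using f(1) order_trans[OF f(2) le] by (intro tracial_state_of_real_functional)
    with assms show False by blast
  qed
  then obtain z where "z \<in> V" "norm (1 - z) < 1" by blast
  then obtain n and x :: "nat \<Rightarrow> 'a" where "norm (1 - (\<Sum>i<n. commutator (star (x i)) (x i))) < 1"
    unfolding V_def by (metis span_sa_commutators)
  then show thesis using contracting_family_if_near_commutators that by blast
qed

text \<open>A trace vanishes on commutators, so \<open>1\<close> would have trace 0.\<close>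

lemma no_tracial_state_if_one_sum_of_commutators:
  fixes \<tau> :: "'a::unital_cstar_algebra \<Rightarrow> complex"
  assumes "sum_of_commutators n (1 :: 'a)"
  shows "\<not> tracial_state \<tau>"
proof
  assume \<tau>: "tracial_state \<tau>"
  have "\<tau> (commutator x y) = 0" for x y
    using tracial_state_add[OF \<tau>, of "commutator x y" "y * x"] \<tau> by (simp add: commutator_def tracial_state_def)
  then have "\<tau> (\<Sum>i=1..n. commutator (x i) (y i)) = 0" for x y
    by (simp add: tracial_state_sum[OF \<tau>])
  then have "\<tau> 1 = 0"
    using assms unfolding sum_of_commutators_def by metis
  then show False using \<tau> by (simp add: tracial_state_def state_def)
qed

theorem theorem1:
  shows "((\<nexists>\<tau> :: 'a::unital_cstar_algebra \<Rightarrow> complex. tracial_state \<tau>) \<longleftrightarrow>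
          (\<exists>n\<ge>2. \<exists>b :: nat \<Rightarrow> 'a. (\<Sum>i=1..n. star (b i) * b i) = 1 \<and>
                                 norm (\<Sum>i=1..n. b i * star (b i)) < 1)) \<and>
         ((\<nexists>\<tau> :: 'a \<Rightarrow> complex. tracial_state \<tau>) \<longleftrightarrow>
          (\<exists>n\<ge>2. (\<forall>a :: 'a. sum_of_commutators n a) \<and>
                  (\<forall>a :: 'a. positive_element a \<longrightarrow> (\<exists>m\<le>n. sum_of_sa_commutators m a))))"
  (is "(?no_trace \<longleftrightarrow> ?contracting) \<and> (_ \<longleftrightarrow> ?commutators)")
proof -
  have "?contracting" if ?no_trace
    using contracting_family_if_no_tracial_state[OF that] by metis
  moreover have "?no_trace" if ?contracting
    using that no_tracial_state_if_contracting by blast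
  moreover have "?commutators" if contracting: ?contracting
  proof -
    obtain n and b :: "nat \<Rightarrow> 'a" where b: "n \<ge> 2" "(\<Sum>i=1..n. star (b i) * b i) = 1"
      "norm (\<Sum>i=1..n. b i * star (b i)) < 1" using contracting by blast
    show ?thesis
    \<comment> \<open>The length of the family in (2) serves for both assertions of (3).\<close>
    proof (rule exI[of _ n], intro conjI allI impI b(1))
      show "sum_of_commutators n a" for a :: 'a
        using eq_sum_commutators[OF b(2,3), of a] unfolding sum_of_commutators_def by metis
      show "\<exists>m\<le>n. sum_of_sa_commutators m a" if "positive_element a" for a :: 'a
        using positive_eq_sum_sa_commutators[OF b(2,3)] that
        unfolding sum_of_sa_commutators_def positive_element_iff_sa_square by (metis order_refl)
    qed
  qed
  moreover have "?no_trace" if ?commutators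
    using that no_tracial_state_if_one_sum_of_commutators by blast
  ultimately show ?thesis by argo
qed

end
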